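(* Let $m\ge2$, let $U_1,\dots,U_m\subset\mathbb{R}^n$ be closed convex sets with $S:=\bigcap_{i=1}^mU_i\neq\varnothing$, and let $$T_{\mathrm{SCCRM}}:=T_{U_m,U_{m-1}}\circ T_{U_{m-1},U_{m-2}}\circ\cdots\circ T_{U_2,U_1},$$ where $T_{A,B}$ is the two-set successive centralized circumcentered reflection operator. Then for all $s\in S$ and all $x\in\mathbb{R}^n$, $$\|T_{\mathrm{SCCRM}}x-s\|^2\le\|x-s\|^2-\frac{1}{4(m-1)}\,\delta(x)^2 .$$
   Context: $P_A$ denotes metric projection onto a closed convex set $A$, and $\delta(x):=\max_{1\le i\le m}\mathrm{dist}(x,U_i)$. For closed convex sets $A,B\subset\mathbb{R}^n$ with $A\cap B\ne\varnothing$ put $$Z_{A,B}:=P_A\circ P_B,\qquad \tilde Z_{A,B}:=\tfrac12(P_A+P_B),\qquad \bar Z_{A,B}:=\tilde Z_{A,B}\circ Z_{A,B},$$ $R_A:=2P_A-I$, $R_B:=2P_B-I$, and $\mathcal C_{A,B}(y):=\operatorname{circ}(y,R_A(y),R_B(y))$, where $\operatorname{circ}(u,v,w)$ (the circumcenter) is the point of the affine hull of $\{u,v,w\}$ equidistant from $u$, $v$ and $w$. The two-set operator is $T_{A,B}(x):=\mathcal C_{A,B}\bigl(\bar Z_{A,B}(x)\bigr)$; the circumcenter is well defined at points of the form $\bar Z_{A,B}(x)$. *)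

theory Defs
  imports "HOL-Analysis.Analysis"
begin

definition reflection :: "'a::euclidean_space set \<Rightarrow> 'a \<Rightarrow> 'a" where
  "reflection A x = 2 *\<^sub>R closest_point A x - x"

text \<open>Unspecified if no equidistant point exists in the affine hull, i.e. if the three points are
  pairwise distinct and collinear; otherwise existence and uniqueness hold.\<close>

definition circumcenter :: "'a::euclidean_space \<Rightarrow> 'a \<Rightarrow> 'a \<Rightarrow> 'a" where
  "circumcenter u v w =
     (THE c. c \<in> affine hull {u, v, w} \<and> dist c u = dist c v \<and> dist c v = dist c w)"

definition alt_proj :: "'a::euclidean_space set \<Rightarrow> 'a set \<Rightarrow> 'a \<Rightarrow> 'a" where
  "alt_proj A B = closest_point A \<circ> closest_point B"

definition avg_proj :: "'a::euclidean_space set \<Rightarrow> 'a set \<Rightarrow> 'a \<Rightarrow> 'a" where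
  "avg_proj A B x = (1/2) *\<^sub>R (closest_point A x + closest_point B x)"

definition centralize :: "'a::euclidean_space set \<Rightarrow> 'a set \<Rightarrow> 'a \<Rightarrow> 'a" where
  "centralize A B = avg_proj A B \<circ> alt_proj A B"

definition circ_refl :: "'a::euclidean_space set \<Rightarrow> 'a set \<Rightarrow> 'a \<Rightarrow> 'a" where
  "circ_refl A B y = circumcenter y (reflection A y) (reflection B y)"

definition ccrm :: "'a::euclidean_space set \<Rightarrow> 'a set \<Rightarrow> 'a \<Rightarrow> 'a" where
  "ccrm A B x = circ_refl A B (centralize A B x)"

text \<open>The list is traversed from the left, so the operator for \<open>U 2, U 1\<close> is applied first
  and the one for \<open>U m, U (m - 1)\<close> last.\<close>

definition sccrm :: "(nat \<Rightarrow> 'a::euclidean_space set) \<Rightarrow> nat \<Rightarrow> 'a \<Rightarrow> 'a" where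
  "sccrm U m = fold (\<lambda>i. ccrm (U (i + 1)) (U i)) [1..<m]"

definition max_dist :: "(nat \<Rightarrow> 'a::euclidean_space set) \<Rightarrow> nat \<Rightarrow> 'a \<Rightarrow> real" where
  "max_dist U m x = Max ((\<lambda>i. infdist x (U i)) ` {1..m})"

end

theory Submission
  imports Defs
begin

text \<open>
  Fix a common point \<open>s\<close>. One two-set step moves \<open>x\<close> along four legs: to \<open>p = P\<^sub>B x\<close>, to
  \<open>q = P\<^sub>A p\<close>, to the midpoint \<open>z\<close> of \<open>q\<close> and \<open>P\<^sub>B q\<close>, and to the circumcenter \<open>c\<close>. Every leg lowers
  the squared distance to \<open>s\<close> by at least its own squared length. For the projections
  this is the obtuse-angle inequality, and for the midpoint it follows by the parallelogram law. For the last leg it depends on the centralization: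
  the displacements \<open>u = P\<^sub>A z - z\<close> and \<open>v = P\<^sub>B z - z\<close> satisfy \<open>u \<bullet> v \<le> 0\<close>, which makes the
  circumcenter the projection of \<open>z\<close> onto the intersection of the two half-spaces
  that support \<open>A\<close> and \<open>B\<close> at \<open>P\<^sub>A z\<close> and \<open>P\<^sub>B z\<close>, and \<open>s\<close> lies in that intersection.

  If \<open>L\<close> is the total length of the four legs, the Cauchy--Schwarz inequality turns the sum of
  their squares into at least \<open>L\<^sup>2 / 4\<close>. Since the path of a step starts at \<open>x\<close>, visits both sets
  and ends at the new iterate, the concatenated path of the \<open>m - 1\<close> steps visits every \<open>U\<^sub>j\<close>, so its
  length bounds every distance from \<open>x\<close> to \<open>U\<^sub>j\<close>. A second use of the Cauchy--Schwarz inequality,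
  now over the \<open>m - 1\<close> steps, gives the factor \<open>1 / (4 (m - 1))\<close>.
\<close>

section \<open>Projections\<close>

lemma closest_point_fejer:
  fixes A :: "'a::euclidean_space set"
  assumes "closed A" "convex A" "s \<in> A"
  shows "(norm (closest_point A x - s))\<^sup>2 \<le> (norm (x - s))\<^sup>2 - (dist x (closest_point A x))\<^sup>2"
proof -
  have "(x - closest_point A x) \<bullet> (s - closest_point A x) \<le> 0"
    using closest_point_dot assms by blast
  then show ?thesis
    by (simp add: dist_norm power2_norm_eq_inner inner_diff_left inner_diff_right inner_commute)
qed

lemma closest_point_eqI_inner:
  fixes A :: "'a::euclidean_space set"
  assumes "closed A" "convex A" "r \<in> A" and r: "\<And>b. b \<in> A \<Longrightarrow> (z - r) \<bullet> (b - r) \<le> 0"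
  shows "closest_point A z = r"
proof -
  let ?c = "closest_point A z"
  have "?c \<in> A" using assms closest_point_in_set by blast
  then have "(z - r) \<bullet> (?c - r) \<le> 0" by (rule r)
  moreover have "(z - ?c) \<bullet> (r - ?c) \<le> 0" using closest_point_dot assms by blast
  ultimately have "(?c - r) \<bullet> (?c - r) \<le> 0"
    by (simp add: inner_diff_left inner_diff_right inner_commute)
  then have "?c - r = 0" using inner_gt_zero_iff[of "?c - r"] by linarith
  then show ?thesis by simp
qed

lemma inner_le_inner_closest_point:
  fixes A :: "'a::euclidean_space set"
  assumes "closed A" "convex A" "s \<in> A"
  shows "(closest_point A z - z) \<bullet> (closest_point A z - z) \<le> (closest_point A z - z) \<bullet> (s - z)"
proof -
  have "(z - closest_point A z) \<bullet> (s - closest_point A z) \<le> 0"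
    using closest_point_dot assms by blast
  then show ?thesis
    by (simp add: inner_diff_left inner_diff_right inner_commute)
qed

text \<open>Averaging a point with its projection stays on the segment between the two, hence does not
  change the projection onto that set.\<close>

lemma closest_point_midpoint:
  fixes B :: "'a::euclidean_space set"
  assumes "closed B" "convex B" "B \<noteq> {}"
  shows "closest_point B ((1/2) *\<^sub>R (q + closest_point B q)) = closest_point B q"
proof (rule closest_point_eqI_inner)
  show "closest_point B q \<in> B" using assms closest_point_in_set by blast
  fix b assume "b \<in> B"
  then have "(q - closest_point B q) \<bullet> (b - closest_point B q) \<le> 0"
    using closest_point_dot assms by blast
  moreover have "(1/2) *\<^sub>R (q + closest_point B q) - closest_point B q
      = (1/2) *\<^sub>R (q - closest_point B q)"
    by (simp add: algebra_simps flip: scaleR_add_left)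
  ultimately show "((1/2) *\<^sub>R (q + closest_point B q) - closest_point B q)
      \<bullet> (b - closest_point B q) \<le> 0" by simp
qed (use assms in auto)

lemma midpoint_fejer:
  fixes q r s :: "'a::real_inner"
  assumes "(norm (r - s))\<^sup>2 \<le> (norm (q - s))\<^sup>2"
  shows "(norm ((1/2) *\<^sub>R (q + r) - s))\<^sup>2 \<le> (norm (q - s))\<^sup>2 - (dist q ((1/2) *\<^sub>R (q + r)))\<^sup>2"
proof -
  have "(norm ((1/2) *\<^sub>R (q + r) - s))\<^sup>2 + (dist q ((1/2) *\<^sub>R (q + r)))\<^sup>2
      = ((norm (q - s))\<^sup>2 + (norm (r - s))\<^sup>2) / 2"
    by (simp add: dist_norm power2_norm_eq_inner inner_diff_left inner_diff_right
        inner_add_left inner_add_right inner_commute field_simps)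
  with assms show ?thesis by argo
qed

section \<open>The circumcenter at an obtuse angle\<close>

text \<open>The Gram system that describes the circumcenter has a nonnegative solution. The vector \<open>w\<close>
  has a positive inner product with each of \<open>u\<close> and \<open>v\<close> that is nonzero. This excludes opposite
  directions of \<open>u\<close> and \<open>v\<close>, the one case at an obtuse angle in which the system is inconsistent.\<close>

lemma obtuse_gram_solution:
  fixes u v w :: "'a::real_inner"
  assumes uv: "u \<bullet> v \<le> 0" and wu: "u \<bullet> u \<le> u \<bullet> w" and wv: "v \<bullet> v \<le> v \<bullet> w"
  obtains a b where "0 \<le> a" "0 \<le> b"
    "(a *\<^sub>R u + b *\<^sub>R v) \<bullet> u = u \<bullet> u" "(a *\<^sub>R u + b *\<^sub>R v) \<bullet> v = v \<bullet> v"
proof -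
  consider "u = 0" | "v = 0" | "u \<noteq> 0" "v \<noteq> 0" by blast
  then show ?thesis
  proof cases
    case 1
    show ?thesis by (rule that[of 0 1]) (use 1 in auto)
  next
    case 2
    show ?thesis by (rule that[of 1 0]) (use 2 in auto)
  next
    case 3
    define k where "k = norm u * norm v"
    have k: "k > 0" using 3 by (simp add: k_def)
    let ?h = "norm v *\<^sub>R u + norm u *\<^sub>R v"
    have "0 < norm v * (u \<bullet> u) + norm u * (v \<bullet> v)"
      using 3 by (intro add_pos_pos mult_pos_pos) auto
    also have "\<dots> \<le> ?h \<bullet> w"
      using wu wv by (simp add: inner_add_left add_mono mult_left_mono)
    finally have "?h \<noteq> 0" by auto
    then have "0 < ?h \<bullet> ?h" by simp
    also have "?h \<bullet> ?h = (norm v)\<^sup>2 * (u \<bullet> u) + 2 * k * (u \<bullet> v) + (norm u)\<^sup>2 * (v \<bullet> v)"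
      unfolding inner_add_left inner_add_right inner_scaleR_left inner_scaleR_right
        inner_commute[of v u]
      by (simp add: k_def power2_eq_square ring_distribs)
    also have "\<dots> = 2 * k * (k + u \<bullet> v)"
      unfolding dot_square_norm k_def by (simp add: power2_eq_square algebra_simps)
    finally have "k + u \<bullet> v > 0" using k by (simp add: zero_less_mult_iff)
    then have "(k + u \<bullet> v) * (k - u \<bullet> v) > 0" using uv k by (intro mult_pos_pos) auto
    moreover have "k * k = (u \<bullet> u) * (v \<bullet> v)"
      by (simp add: k_def dot_square_norm power2_eq_square)
    ultimately have D: "(u \<bullet> u) * (v \<bullet> v) - (u \<bullet> v) * (u \<bullet> v) > 0" (is "?D > 0")
      by (simp add: algebra_simps)
    \<comment> \<open>Cramer's rule for the Gram matrix of \<open>u\<close> and \<open>v\<close>.\<close>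
    let ?a = "(v \<bullet> v) * (u \<bullet> u - u \<bullet> v) / ?D" and ?b = "(u \<bullet> u) * (v \<bullet> v - u \<bullet> v) / ?D"
    have cu: "v \<bullet> u = u \<bullet> v" by (rule inner_commute)
    show ?thesis
    proof (rule that[of ?a ?b])
      have "u \<bullet> u - u \<bullet> v \<ge> 0" "v \<bullet> v - u \<bullet> v \<ge> 0"
        using uv inner_ge_zero[of u] inner_ge_zero[of v] by linarith+
      then show "0 \<le> ?a" "0 \<le> ?b" using D by auto
      have "?a * (u \<bullet> u) + ?b * (u \<bullet> v) = (u \<bullet> u) * ?D / ?D"
        unfolding times_divide_eq_left add_divide_distrib[symmetric] by (simp add: algebra_simps)
      then show "(?a *\<^sub>R u + ?b *\<^sub>R v) \<bullet> u = u \<bullet> u"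
        using D by (simp add: inner_add_left cu)
      have "?a * (u \<bullet> v) + ?b * (v \<bullet> v) = (v \<bullet> v) * ?D / ?D"
        unfolding times_divide_eq_left add_divide_distrib[symmetric] by (simp add: algebra_simps)
      then show "(?a *\<^sub>R u + ?b *\<^sub>R v) \<bullet> v = v \<bullet> v"
        using D by (simp add: inner_add_left)
    qed
  qed
qed

lemma dist_eq_reflected_iff:
  fixes d u z :: "'a::real_inner"
  shows "dist (z + d) z = dist (z + d) (z + 2 *\<^sub>R u) \<longleftrightarrow> d \<bullet> u = u \<bullet> u"
proof -
  have "dist (z + d) z = dist (z + d) (z + 2 *\<^sub>R u) \<longleftrightarrow> norm d = norm (d - 2 *\<^sub>R u)"
    by (simp add: dist_norm)
  also have "\<dots> \<longleftrightarrow> d \<bullet> d = (d - 2 *\<^sub>R u) \<bullet> (d - 2 *\<^sub>R u)"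
    by (rule norm_eq)
  finally show ?thesis
    by (auto simp: inner_diff_left inner_diff_right inner_commute)
qed

lemma affine_hull_reflected:
  fixes u v z :: "'a::real_vector"
  shows "affine hull {z, z + 2 *\<^sub>R u, z + 2 *\<^sub>R v} = {z + (a *\<^sub>R u + b *\<^sub>R v) | a b. True}"
proof safe
  fix c assume "c \<in> affine hull {z, z + 2 *\<^sub>R u, z + 2 *\<^sub>R v}"
  then obtain l m n where 1: "l + m + n = 1"
    and c: "c = l *\<^sub>R z + m *\<^sub>R (z + 2 *\<^sub>R u) + n *\<^sub>R (z + 2 *\<^sub>R v)"
    unfolding affine_hull_3 by blast
  have "c = (l + m + n) *\<^sub>R z + ((2 * m) *\<^sub>R u + (2 * n) *\<^sub>R v)"
    unfolding c by (simp add: algebra_simps)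
  then show "\<exists>a b. c = z + (a *\<^sub>R u + b *\<^sub>R v) \<and> True" unfolding 1 by auto
next
  fix a b :: real
  have "z + (a *\<^sub>R u + b *\<^sub>R v)
      = (1 - a/2 - b/2) *\<^sub>R z + (a/2) *\<^sub>R (z + 2 *\<^sub>R u) + (b/2) *\<^sub>R (z + 2 *\<^sub>R v)"
    by (simp add: algebra_simps)
  then show "z + (a *\<^sub>R u + b *\<^sub>R v) \<in> affine hull {z, z + 2 *\<^sub>R u, z + 2 *\<^sub>R v}"
    unfolding affine_hull_3 by force
qed

text \<open>Two solutions of the Gram system differ by a combination of \<open>u\<close> and \<open>v\<close> that is orthogonal
  to both, hence vanishes; this covers coincident and collinear points as well.\<close>

lemma circumcenter_eqI:
  fixes u v z :: "'a::euclidean_space"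
  assumes d: "d = a *\<^sub>R u + b *\<^sub>R v" and du: "d \<bullet> u = u \<bullet> u" and dv: "d \<bullet> v = v \<bullet> v"
  shows "circumcenter z (z + 2 *\<^sub>R u) (z + 2 *\<^sub>R v) = z + d"
  unfolding circumcenter_def
proof (rule the_equality)
  show "z + d \<in> affine hull {z, z + 2 *\<^sub>R u, z + 2 *\<^sub>R v} \<and>
      dist (z + d) z = dist (z + d) (z + 2 *\<^sub>R u) \<and>
      dist (z + d) (z + 2 *\<^sub>R u) = dist (z + d) (z + 2 *\<^sub>R v)"
    using dist_eq_reflected_iff[of z d u] dist_eq_reflected_iff[of z d v] du dv d
    unfolding affine_hull_reflected by auto
next
  fix c
  assume c: "c \<in> affine hull {z, z + 2 *\<^sub>R u, z + 2 *\<^sub>R v} \<and>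
      dist c z = dist c (z + 2 *\<^sub>R u) \<and> dist c (z + 2 *\<^sub>R u) = dist c (z + 2 *\<^sub>R v)"
  then obtain a' b' where c_eq: "c = z + (a' *\<^sub>R u + b' *\<^sub>R v)"
    unfolding affine_hull_reflected by blast
  define e where "e = a' *\<^sub>R u + b' *\<^sub>R v"
  have ce: "c = z + e" by (simp add: c_eq e_def)
  have "e \<bullet> u = u \<bullet> u" "e \<bullet> v = v \<bullet> v"
    using c unfolding ce by (simp_all flip: dist_eq_reflected_iff[of z e])
  then have orth: "(e - d) \<bullet> u = 0" "(e - d) \<bullet> v = 0"
    using du dv by (simp_all add: inner_diff_left)
  have "(e - d) \<bullet> (e - d) = (e - d) \<bullet> ((a' - a) *\<^sub>R u + (b' - b) *\<^sub>R v)"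
    by (simp add: e_def d algebra_simps)
  also have "\<dots> = 0" using orth by (simp add: inner_add_right)
  finally show "c = z + d" by (simp add: ce)
qed

text \<open>With nonnegative coefficients the half-space inequalities for \<open>s\<close> add up to
  \<open>d \<bullet> d \<le> d \<bullet> (s - z)\<close> for the displacement \<open>d\<close> of the circumcenter from \<open>z\<close>.\<close>

lemma circumcenter_fejer:
  fixes u v z s :: "'a::euclidean_space"
  assumes "u \<bullet> v \<le> 0" and us: "u \<bullet> u \<le> u \<bullet> (s - z)" and vs: "v \<bullet> v \<le> v \<bullet> (s - z)"
  defines "c \<equiv> circumcenter z (z + 2 *\<^sub>R u) (z + 2 *\<^sub>R v)"
  shows "(norm (c - s))\<^sup>2 \<le> (norm (z - s))\<^sup>2 - (dist z c)\<^sup>2"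
proof -
  obtain a b where ab: "0 \<le> a" "0 \<le> b"
    and eqs: "(a *\<^sub>R u + b *\<^sub>R v) \<bullet> u = u \<bullet> u" "(a *\<^sub>R u + b *\<^sub>R v) \<bullet> v = v \<bullet> v"
    using obtuse_gram_solution[OF assms(1-3)] by blast
  define d where "d = a *\<^sub>R u + b *\<^sub>R v"
  have c: "c = z + d"
    unfolding c_def using eqs by (intro circumcenter_eqI[OF d_def]) (simp_all add: d_def)
  have "d \<bullet> d = a * (d \<bullet> u) + b * (d \<bullet> v)"
    by (subst (2) d_def) (simp add: inner_add_right)
  also have "\<dots> = a * (u \<bullet> u) + b * (v \<bullet> v)" using eqs by (simp add: d_def)
  also have "\<dots> \<le> a * (u \<bullet> (s - z)) + b * (v \<bullet> (s - z))"
    using ab us vs by (intro add_mono mult_left_mono)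
  also have "\<dots> = d \<bullet> (s - z)" by (simp add: d_def inner_add_left)
  finally show ?thesis
    unfolding c
    by (simp add: dist_norm power2_norm_eq_inner inner_diff_left inner_diff_right
        inner_add_left inner_add_right inner_commute)
qed

section \<open>One two-set step\<close>

text \<open>Centralization produces the obtuse angle: seen from \<open>z\<close>, the point \<open>q\<close> of \<open>A\<close> lies exactly
  opposite to \<open>P\<^sub>B z\<close>, while no point of \<open>A\<close> makes an obtuse angle with the direction of \<open>P\<^sub>A z\<close>.\<close>

lemma centralized_obtuse:
  fixes A B :: "'a::euclidean_space set"
  assumes A: "closed A" "convex A" and B: "closed B" "convex B" "B \<noteq> {}" and q: "q \<in> A"
  defines "z \<equiv> (1/2) *\<^sub>R (q + closest_point B q)"
  shows "(closest_point A z - z) \<bullet> (closest_point B z - z) \<le> 0"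
proof -
  have "closest_point B z = closest_point B q"
    unfolding z_def by (rule closest_point_midpoint[OF B])
  moreover have "2 *\<^sub>R z = q + closest_point B q" by (simp add: z_def)
  ultimately have "closest_point B z = 2 *\<^sub>R z - q" by (simp add: algebra_simps)
  then have "closest_point B z - z = - (q - z)" by (simp add: scaleR_2)
  moreover have "0 \<le> (closest_point A z - z) \<bullet> (q - z)"
    using inner_le_inner_closest_point[OF A q] inner_ge_zero order_trans by blast
  ultimately show ?thesis by (simp only: inner_minus_right neg_le_0_iff_le)
qed

text \<open>The witness for \<open>L\<close> is the length of the path from \<open>x\<close> along the four legs of the step.\<close>

lemma ccrm_step:
  fixes A B :: "'a::euclidean_space set"
  assumes A: "closed A" "convex A" "s \<in> A" and B: "closed B" "convex B" "s \<in> B"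
  obtains L where "0 \<le> L" "(norm (ccrm A B x - s))\<^sup>2 \<le> (norm (x - s))\<^sup>2 - L\<^sup>2 / 4"
    "dist x (ccrm A B x) \<le> L" "infdist x A \<le> L" "infdist x B \<le> L"
proof -
  define p where "p = closest_point B x"
  define q where "q = closest_point A p"
  define z where "z = (1/2) *\<^sub>R (q + closest_point B q)"
  define c where "c = ccrm A B x"
  define L where "L = dist x p + dist p q + dist q z + dist z c"
  have pB: "p \<in> B" unfolding p_def using B closest_point_in_set by blast
  have qA: "q \<in> A" unfolding q_def using A closest_point_in_set by blast
  have z: "centralize A B x = z"
    using qA by (simp add: centralize_def avg_proj_def alt_proj_def z_def q_def p_def
        closest_point_self)
  have c: "c = circumcenter z (z + 2 *\<^sub>R (closest_point A z - z)) (z + 2 *\<^sub>R (closest_point B z - z))"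
    by (simp add: c_def ccrm_def z circ_refl_def reflection_def algebra_simps scaleR_2)
  have "(norm (p - s))\<^sup>2 \<le> (norm (x - s))\<^sup>2 - (dist x p)\<^sup>2"
    unfolding p_def by (rule closest_point_fejer[OF B])
  moreover have "(norm (q - s))\<^sup>2 \<le> (norm (p - s))\<^sup>2 - (dist p q)\<^sup>2"
    unfolding q_def by (rule closest_point_fejer[OF A])
  moreover have "(norm (z - s))\<^sup>2 \<le> (norm (q - s))\<^sup>2 - (dist q z)\<^sup>2"
    unfolding z_def
    using closest_point_fejer[OF B, of q] zero_le_power2[of "dist q (closest_point B q)"]
    by (intro midpoint_fejer) linarith
  moreover have "(norm (c - s))\<^sup>2 \<le> (norm (z - s))\<^sup>2 - (dist z c)\<^sup>2"
    unfolding c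
  proof (rule circumcenter_fejer)
    show "(closest_point A z - z) \<bullet> (closest_point B z - z) \<le> 0"
      unfolding z_def using A B qA by (intro centralized_obtuse) auto
  qed (use A B inner_le_inner_closest_point in blast)+
  moreover have "L\<^sup>2 \<le> 4 * ((dist x p)\<^sup>2 + (dist p q)\<^sup>2 + (dist q z)\<^sup>2 + (dist z c)\<^sup>2)"
  proof -
    have "(e + f + g + h)\<^sup>2 \<le> 4 * (e\<^sup>2 + f\<^sup>2 + g\<^sup>2 + h\<^sup>2)" for e f g h :: real
    proof -
      have "4 * (e\<^sup>2 + f\<^sup>2 + g\<^sup>2 + h\<^sup>2) - (e + f + g + h)\<^sup>2
          = (e - f)\<^sup>2 + (e - g)\<^sup>2 + (e - h)\<^sup>2 + (f - g)\<^sup>2 + (f - h)\<^sup>2 + (g - h)\<^sup>2"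
        by (simp add: power2_eq_square algebra_simps)
      also have "\<dots> \<ge> 0" by simp
      finally show ?thesis by simp
    qed
    then show ?thesis unfolding L_def .
  qed
  ultimately have fejer: "(norm (c - s))\<^sup>2 \<le> (norm (x - s))\<^sup>2 - L\<^sup>2 / 4" by argo
  have "dist x c \<le> L"
    unfolding L_def
    using dist_triangle[of x c p] dist_triangle[of p c q] dist_triangle[of q c z] by linarith
  moreover have "infdist x A \<le> L"
    unfolding L_def
    using infdist_le[OF qA, of x] dist_triangle[of x q p]
      zero_le_dist[of q z] zero_le_dist[of z c] by linarith
  moreover have "infdist x B \<le> L"
    unfolding L_def
    using infdist_le[OF pB, of x] zero_le_dist[of p q] zero_le_dist[of q z] zero_le_dist[of z c]
    by linarith
  moreover have "0 \<le> L" by (simp add: L_def)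
  ultimately show ?thesis using that fejer unfolding c_def by blast
qed

section \<open>Composition of the steps\<close>

lemma sccrm_1: "sccrm U 1 x = x"
  by (simp add: sccrm_def)

lemma sccrm_Suc: "k \<ge> 1 \<Longrightarrow> sccrm U (Suc k) x = ccrm (U (Suc k)) (U k) (sccrm U k x)"
  by (simp add: sccrm_def)

lemma telescoped_steps:
  fixes y :: "nat \<Rightarrow> 'a::real_normed_vector" and L :: "nat \<Rightarrow> real"
  assumes step: "\<And>k. 1 \<le> k \<Longrightarrow> k < m \<Longrightarrow>
      (norm (y (Suc k) - s))\<^sup>2 \<le> (norm (y k - s))\<^sup>2 - (L k)\<^sup>2 / 4 \<and> dist (y k) (y (Suc k)) \<le> L k"
    and "1 \<le> n" "n \<le> m"
  shows "(norm (y n - s))\<^sup>2 \<le> (norm (y 1 - s))\<^sup>2 - (\<Sum>i=1..<n. (L i)\<^sup>2) / 4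
    \<and> dist (y 1) (y n) \<le> (\<Sum>i=1..<n. L i)"
  using assms(2,3)
proof (induction n rule: dec_induct)
  case base
  then show ?case by simp
next
  case (step k)
  have "dist (y 1) (y (Suc k)) \<le> dist (y 1) (y k) + dist (y k) (y (Suc k))"
    by (rule dist_triangle)
  with step assms(1)[of k] show ?case
    by (auto simp: add_divide_distrib)
qed

theorem mainTheorem8:
  fixes U :: "nat \<Rightarrow> (real ^ 'n) set" and m :: nat
  assumes "m \<ge> 2"
    and "\<And>i. i \<in> {1..m} \<Longrightarrow> closed (U i)"
    and "\<And>i. i \<in> {1..m} \<Longrightarrow> convex (U i)"
    and "(\<Inter>i\<in>{1..m}. U i) \<noteq> {}"
  shows "\<forall>s\<in>(\<Inter>i\<in>{1..m}. U i). \<forall>x.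
    (norm (sccrm U m x - s))\<^sup>2
      \<le> (norm (x - s))\<^sup>2 - 1 / (4 * (real m - 1)) * (max_dist U m x)\<^sup>2"
proof (intro ballI allI)
  fix s x assume s: "s \<in> (\<Inter>i\<in>{1..m}. U i)"
  define y where "y k = sccrm U k x" for k
  have y1: "y 1 = x" unfolding y_def by (rule sccrm_1)
  have "\<exists>L. 0 \<le> L \<and> (norm (y (Suc k) - s))\<^sup>2 \<le> (norm (y k - s))\<^sup>2 - L\<^sup>2 / 4 \<and>
      dist (y k) (y (Suc k)) \<le> L \<and> infdist (y k) (U (Suc k)) \<le> L \<and> infdist (y k) (U k) \<le> L"
    if "1 \<le> k" "k < m" for k
  proof -
    have "k \<in> {1..m}" "Suc k \<in> {1..m}" using that by auto
    then obtain L where "0 \<le> L"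
      "(norm (ccrm (U (Suc k)) (U k) (y k) - s))\<^sup>2 \<le> (norm (y k - s))\<^sup>2 - L\<^sup>2 / 4"
      "dist (y k) (ccrm (U (Suc k)) (U k) (y k)) \<le> L"
      "infdist (y k) (U (Suc k)) \<le> L" "infdist (y k) (U k) \<le> L"
      using ccrm_step[of "U (Suc k)" s "U k" "y k"] assms(2,3) s by blast
    then show ?thesis using sccrm_Suc[OF that(1), of U x] unfolding y_def by auto
  qed
  then obtain L where L: "\<And>k. 1 \<le> k \<Longrightarrow> k < m \<Longrightarrow> 0 \<le> L k \<and>
      (norm (y (Suc k) - s))\<^sup>2 \<le> (norm (y k - s))\<^sup>2 - (L k)\<^sup>2 / 4 \<and>
      dist (y k) (y (Suc k)) \<le> L k \<and>
      infdist (y k) (U (Suc k)) \<le> L k \<and> infdist (y k) (U k) \<le> L k"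
    by metis
  have tel: "(norm (y n - s))\<^sup>2 \<le> (norm (x - s))\<^sup>2 - (\<Sum>i=1..<n. (L i)\<^sup>2) / 4
      \<and> dist x (y n) \<le> (\<Sum>i=1..<n. L i)" if "1 \<le> n" "n \<le> m" for n
    using telescoped_steps[of m y s L n] L that unfolding y1 by blast
  have dist_bound: "infdist x (U j) \<le> (\<Sum>i=1..<m. L i)" if j: "j \<in> {1..m}" for j
  proof -
    \<comment> \<open>The set \<open>U j\<close> is visited in step \<open>j - 1\<close>, except that \<open>U 1\<close> is visited in step \<open>1\<close>.\<close>
    define k where "k = max 1 (j - 1)"
    have k: "1 \<le> k" "k < m" "j = k \<or> j = Suc k" using j assms(1) by (auto simp: k_def)
    have "infdist x (U j) \<le> infdist (y k) (U j) + dist x (y k)" by (rule infdist_triangle)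
    also have "\<dots> \<le> L k + (\<Sum>i=1..<k. L i)" using L[OF k(1,2)] tel[of k] k by auto
    also have "\<dots> = (\<Sum>i=1..<Suc k. L i)" using k by simp
    also have "\<dots> \<le> (\<Sum>i=1..<m. L i)" using L k by (intro sum_mono2) auto
    finally show ?thesis .
  qed
  have max_le: "max_dist U m x \<le> (\<Sum>i=1..<m. L i)"
    unfolding max_dist_def using dist_bound assms(1) by (subst Max_le_iff) auto
  have "0 \<le> infdist x (U 1)" by (rule infdist_nonneg)
  also have "\<dots> \<le> max_dist U m x"
    unfolding max_dist_def using assms(1) by (intro Max_ge) auto
  finally have "(max_dist U m x)\<^sup>2 \<le> (\<Sum>i=1..<m. L i)\<^sup>2"
    using max_le by (intro power_mono)
  also have "\<dots> \<le> (\<Sum>i=1..<m. (L i)\<^sup>2) * (real m - 1)"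
    using sum_squared_le_sum_of_squares[of L "{1..<m}"] assms(1) by (simp add: of_nat_diff)
  finally have "1 / (4 * (real m - 1)) * (max_dist U m x)\<^sup>2 \<le> (\<Sum>i=1..<m. (L i)\<^sup>2) / 4"
    using assms(1) by (simp add: field_simps)
  with tel[of m] assms(1)
  show "(norm (sccrm U m x - s))\<^sup>2
      \<le> (norm (x - s))\<^sup>2 - 1 / (4 * (real m - 1)) * (max_dist U m x)\<^sup>2"
    by (simp add: y_def)
qed

end
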